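(* Let $k > 0$ be a real number, and let $\{a_n\}_{n\in\mathbb{N}}$ and $\{b_n\}_{n\in\mathbb{N}}$ be two sequences of positive real numbers such that $a_n \to +\infty$ as $n\to\infty$ and $b_n \sim k\cdot a_n$ as $n\to\infty$. Then $$\lim_{n\to\infty}\left(1+\frac{1}{a_n}\right)^{b_n} = e^{k}.$$
   Context: The asymptotic formula $b_n \sim k\cdot a_n$ means that $\lim_{n\to\infty} \frac{b_n}{k\,a_n} = 1$. Here $e$ is Euler's number, $e = \lim_{n\to\infty}\left(1+\frac{1}{n}\right)^n$, and powers are real powers of positive real numbers. *)

theory Defs
  imports "HOL-Analysis.Analysis"
begin

text \<open>Euler's number is rendered by the library as \<open>exp 1\<close>; this agrees with
  its description as the limit of \<open>(1 + 1/n)^n\<close>.\<close>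

lemma euler_number_limit: "(\<lambda>n. (1 + 1 / real n) ^ n) \<longlonglongrightarrow> exp (1::real)"
  using tendsto_exp_limit_sequentially[of "1::real"] by simp

end

theory Submission
  imports Defs
begin

text \<open>Split the power as \<open>((1 + 1 / a n) powr a n) powr (b n / a n)\<close>. The inner
  power tends to e because \<open>a\<close> tends to infinity, the outer exponent tends to
  \<open>k\<close>, and \<open>powr\<close> is jointly continuous at (e, k) since e is
  nonzero.\<close>

theorem mainTheorem1:
  fixes k :: real and a b :: "nat \<Rightarrow> real"
  assumes "k > 0"
    and "\<And>n. a n > 0"
    and "\<And>n. b n > 0"
    and "filterlim a at_top sequentially"
    and "(\<lambda>n. b n / (k * a n)) \<longlonglongrightarrow> 1"
  shows "(\<lambda>n. (1 + 1 / a n) powr b n) \<longlonglongrightarrow> exp 1 powr k"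
proof -
  have base: "(\<lambda>n. (1 + 1 / a n) powr a n) \<longlonglongrightarrow> exp 1"
    using filterlim_compose[OF tendsto_exp_limit_at_top assms(4)] .
  have expo: "(\<lambda>n. k * (b n / (k * a n))) \<longlonglongrightarrow> k"
    using tendsto_mult_left[OF assms(5), of k] by simp
  have "(\<lambda>n. ((1 + 1 / a n) powr a n) powr (k * (b n / (k * a n)))) \<longlonglongrightarrow> exp 1 powr k"
    using tendsto_powr[OF base expo] by simp
  \<comment> \<open>Iterated exponents multiply, and \<open>a n * (k * (b n / (k * a n)))\<close>
    cancels to \<open>b n\<close> because \<open>k\<close> and \<open>a n\<close> are
    nonzero.\<close>
  moreover have "((1 + 1 / a n) powr a n) powr (k * (b n / (k * a n))) = (1 + 1 / a n) powr b n" for n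
    using assms(1) assms(2)[of n] by (simp add: powr_powr)
  ultimately show ?thesis by simp
qed

end
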